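(* Let $a\geq 1$ and $b\geq 2$ be integers. Then for Lebesgue-almost every $x\in\Lambda^{a+b}$ the limit $\lim_{k\to\infty}T_{a,b}^k(x)$ exists and equals $(0,\ldots,0,x^{\infty}_{a+2},\ldots,x^{\infty}_{a+b})$ (the first $a+1$ coordinates being $0$), where $0<x^{\infty}_{a+2}\leq\cdots\leq x^{\infty}_{a+b}$.
   Context: For $n\geq 1$ let $\Lambda^n=\{x=(x_1,\ldots,x_n)\in\mathbb{R}^n : 0\leq x_1\leq x_2\leq\cdots\leq x_n\}$. For integers $a,b\geq 1$ the map $T_{a,b}:\Lambda^{a+b}\to\Lambda^{a+b}$ is defined by letting $T_{a,b}(x)$ be the vector obtained by arranging the numbers $x_1,\ldots,x_a,\,x_{a+1}-x_a,\ldots,x_{a+b}-x_a$ in nondecreasing order. *)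

theory Defs
  imports "HOL-Analysis.Analysis"
begin

text \<open>Vectors in R^n are represented as extensional functions
  x :: nat => real with index set {..<n} (0-based: x_1,...,x_n of the paper
  are x 0, ..., x (n-1)). Lebesgue measure on R^n is the product measure
  PiM {..<n} (\<lambda>_. lborel).\<close>

definition Lambda :: "nat \<Rightarrow> (nat \<Rightarrow> real) set" where
  "Lambda n = {x \<in> PiE {..<n} (\<lambda>_. UNIV).
      (0 < n \<longrightarrow> 0 \<le> x 0) \<and> (\<forall>i. Suc i < n \<longrightarrow> x i \<le> x (Suc i))}"

definition T :: "nat \<Rightarrow> nat \<Rightarrow> (nat \<Rightarrow> real) \<Rightarrow> (nat \<Rightarrow> real)" where
  "T a b x = (let vals = map x [0..<a] @ map (\<lambda>i. x i - x (a - 1)) [a..<a+b]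
              in restrict (\<lambda>i. sort vals ! i) {..<a+b})"

end

theory Submission
  imports Defs
begin

text \<open>
  Drop the sorting: on the orthant, \<open>step\<close> subtracts the a-th smallest coordinate from the larger
  ones, and \<open>T\<^sup>k x\<close> is the sorted vector of \<open>step\<^sup>k x\<close>. According to the set \<open>J\<close> of the a
  smallest coordinates, \<open>step\<close> splits into branches that are volume-preserving shears onto the whole
  orthant. Hence a measure with density \<open>h\<close> that is antitone in each coordinate is pushed along a
  branch to a measure of the same kind.

  If, for some set \<open>K\<close> of a + 1 indices, every coordinate outside \<open>K\<close> exceeds the sum over \<open>K\<close>, then
  this persists and all later sets \<open>J\<close> lie in \<open>K\<close>. Multiplying the a + 1 smallest coordinates by
  1 / (a + 2) leads into this region and can only increase \<open>h\<close>, so the region has at least a fixed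
  proportion of the mass of every such measure. Restarting at each exit from \<open>K\<close> gives a geometric
  decay: almost surely the sets \<open>J\<close> finally stay within one \<open>K\<close>. From then on \<open>x\<^sub>i - (\<Sum>l\<in>K. x\<^sub>l)\<close> is
  constant for i outside \<open>K\<close>, while the coordinates in \<open>K\<close> tend to 0; so this constant is the limit
  of \<open>x\<^sub>i\<close>, and it is nonzero off a null set of hyperplanes.
\<close>

section \<open>Affine substitutions and null graphs for product Lebesgue measure\<close>

text \<open>Fubini with the coordinate \<open>i\<close> integrated innermost: since \<open>g\<close>
  does not see \<open>x i\<close>, it is a constant there, and the inner integral undergoes a
  one-dimensional affine substitution.\<close>

lemma nn_integral_PiM_affine_coord:
  fixes f :: "('i \<Rightarrow> real) \<Rightarrow> ennreal" and g :: "('i \<Rightarrow> real) \<Rightarrow> real"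
  assumes I: "finite I" "i \<in> I" and c: "c \<noteq> 0"
    and g: "g \<in> borel_measurable (PiM I (\<lambda>_. lborel))"
    and indep: "\<And>x y. g (x(i := y)) = g x"
    and f: "f \<in> borel_measurable (PiM I (\<lambda>_. lborel))"
  shows "(\<integral>\<^sup>+x. f x \<partial>PiM I (\<lambda>_. lborel))
    = ennreal \<bar>c\<bar> * (\<integral>\<^sup>+x. f (x(i := c * x i + g x)) \<partial>PiM I (\<lambda>_. lborel))"
proof -
  interpret product_sigma_finite "\<lambda>_::'i. lborel :: real measure" ..
  define J where "J = I - {i}"
  have J: "I = insert i J" "finite J" "i \<notin> J" using I by (auto simp: J_def)
  have upd [measurable]: "(\<lambda>(x, y). x(i := y)) \<in> PiM J (\<lambda>_. lborel) \<Otimes>\<^sub>M lborel \<rightarrow>\<^sub>M PiM I (\<lambda>_. lborel :: real measure)"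
    unfolding J(1) by (rule measurable_add_dim)
  note [measurable] = f g
  have m: "(\<lambda>x. x(i := c * x i + g x)) \<in> PiM I (\<lambda>_. lborel) \<rightarrow>\<^sub>M PiM I (\<lambda>_. lborel :: real measure)"
    using I by (intro measurable_fun_upd[where J = "I"]) auto
  have fm: "(\<lambda>y. f (x(i := y))) \<in> borel_measurable borel" if "x \<in> space (PiM J (\<lambda>_. lborel))" for x
  proof -
    have "(\<lambda>y. f ((\<lambda>(x, y). x(i := y)) (x, y))) \<in> borel_measurable lborel"
      using that by measurable
    then show ?thesis by simp
  qed
  have "(\<integral>\<^sup>+x. f x \<partial>PiM I (\<lambda>_. lborel)) = (\<integral>\<^sup>+x. (\<integral>\<^sup>+y. f (x(i := y)) \<partial>lborel) \<partial>PiM J (\<lambda>_. lborel))"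
    using J f by (simp add: product_nn_integral_insert)
  also have "\<dots> = (\<integral>\<^sup>+x. ennreal \<bar>c\<bar> * (\<integral>\<^sup>+y. f (x(i := g x + c * y)) \<partial>lborel) \<partial>PiM J (\<lambda>_. lborel))"
    by (intro nn_integral_cong nn_integral_real_affine fm c) auto
  also have "\<dots> = (\<integral>\<^sup>+x. ennreal \<bar>c\<bar> * (\<integral>\<^sup>+y. f ((x(i := y))(i := c * (x(i := y)) i + g (x(i := y)))) \<partial>lborel) \<partial>PiM J (\<lambda>_. lborel))"
    by (simp add: indep add.commute)
  also have "\<dots> = ennreal \<bar>c\<bar> * (\<integral>\<^sup>+x. (\<integral>\<^sup>+y. f ((x(i := y))(i := c * (x(i := y)) i + g (x(i := y)))) \<partial>lborel) \<partial>PiM J (\<lambda>_. lborel))"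
  proof (rule nn_integral_cmult)
    have "(\<lambda>(x,y). (\<lambda>x. f (x(i := c * x i + g x))) ((\<lambda>(x, y). x(i := y)) (x,y)))
      \<in> borel_measurable (PiM J (\<lambda>_. lborel) \<Otimes>\<^sub>M lborel)"
      using m by measurable
    then show "(\<lambda>x. \<integral>\<^sup>+y. f ((x(i := y))(i := c * (x(i := y)) i + g (x(i := y)))) \<partial>lborel) \<in> borel_measurable (PiM J (\<lambda>_. lborel))"
      using lborel.borel_measurable_nn_integral by (simp add: case_prod_beta' )
  qed
  also have "\<dots> = ennreal \<bar>c\<bar> * (\<integral>\<^sup>+x. f (x(i := c * x i + g x)) \<partial>PiM I (\<lambda>_. lborel))"
    unfolding J(1) using J m f
    by (subst product_nn_integral_insert) (auto intro: measurable_compose)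
  finally show ?thesis .
qed

text \<open>The coordinates in \<open>B\<close> are substituted one after another, each contributing
  a factor \<open>\<bar>c\<bar>\<close>; \<open>g\<close> depends only on coordinates outside
  \<open>B\<close>, so it is the same at every stage. The instances needed are shears
  (\<open>c = 1\<close>) and scalings (\<open>g = 0\<close>).\<close>

lemma nn_integral_PiM_affine:
  fixes f :: "('i \<Rightarrow> real) \<Rightarrow> ennreal" and g :: "('i \<Rightarrow> real) \<Rightarrow> real"
  assumes I: "finite I" "B \<subseteq> I" and c: "c \<noteq> 0"
    and g: "g \<in> borel_measurable (PiM I (\<lambda>_. lborel))"
    and indep: "\<And>x y. (\<And>i. i \<notin> B \<Longrightarrow> x i = y i) \<Longrightarrow> g x = g y"
    and f: "f \<in> borel_measurable (PiM I (\<lambda>_. lborel))"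
  shows "(\<integral>\<^sup>+x. f x \<partial>PiM I (\<lambda>_. lborel))
    = ennreal (\<bar>c\<bar> ^ card B) * (\<integral>\<^sup>+x. f (\<lambda>i. if i \<in> B then c * x i + g x else x i) \<partial>PiM I (\<lambda>_. lborel))"
proof -
  have fin: "finite B" using I finite_subset by blast
  have "(\<integral>\<^sup>+x. f x \<partial>PiM I (\<lambda>_. lborel))
    = ennreal (\<bar>c\<bar> ^ card A) * (\<integral>\<^sup>+x. f (\<lambda>i. if i \<in> A then c * x i + g x else x i) \<partial>PiM I (\<lambda>_. lborel))"
    if "A \<subseteq> B" for A
    using finite_subset[OF that fin] that
  proof (induction A rule: finite_induct)
    case empty
    then show ?case by simp
  next
    case (insert b A)
    let ?S = "\<lambda>A x i. if i \<in> A then c * x i + g x else x i"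
    have S: "?S A \<in> PiM I (\<lambda>_. lborel) \<rightarrow>\<^sub>M PiM I (\<lambda>_. lborel :: real measure)"
    proof (rule measurable_PiM_single')
      fix i assume i: "i \<in> I"
      note [measurable] = g
      show "(\<lambda>x. ?S A x i) \<in> PiM I (\<lambda>_. lborel) \<rightarrow>\<^sub>M lborel" using i by measurable
    next
      show "?S A \<in> space (PiM I (\<lambda>_. lborel)) \<rightarrow> (\<Pi>\<^sub>E i\<in>I. space lborel)"
        using insert.prems I by (auto simp: space_PiM PiE_def extensional_def)
    qed
    have gb: "g (x(b := y)) = g x" for x y
      using insert.prems by (intro indep) auto
    have "(\<integral>\<^sup>+x. f (?S A x) \<partial>PiM I (\<lambda>_. lborel))
      = ennreal \<bar>c\<bar> * (\<integral>\<^sup>+x. f (?S A (x(b := c * x b + g x))) \<partial>PiM I (\<lambda>_. lborel))"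
      using insert.prems I c g gb measurable_compose[OF S f]
      by (intro nn_integral_PiM_affine_coord) auto
    also have "(\<lambda>x. ?S A (x(b := c * x b + g x))) = ?S (insert b A)"
      using insert.hyps by (auto simp: gb fun_eq_iff)
    finally show ?case
      using insert by (simp add: ennreal_mult mult.assoc[symmetric] mult.commute)
  qed
  then show ?thesis by simp
qed

text \<open>The exceptional set is a graph over the other coordinates: it meets each line in
  direction \<open>i\<close> in at most one point, so Fubini gives measure 0.\<close>

lemma AE_PiM_neq:
  fixes g :: "('i \<Rightarrow> real) \<Rightarrow> real"
  assumes I: "finite I" "i \<in> I"
    and g [measurable]: "g \<in> borel_measurable (PiM I (\<lambda>_. lborel))"
    and indep: "\<And>x y. g (x(i := y)) = g x"
  shows "AE x in PiM I (\<lambda>_. lborel). x i \<noteq> g x"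
proof -
  interpret product_sigma_finite "\<lambda>_::'i. lborel :: real measure" ..
  define J where "J = I - {i}"
  have J: "I = insert i J" "finite J" "i \<notin> J" using I by (auto simp: J_def)
  define N where "N = {x \<in> space (PiM I (\<lambda>_. lborel)). x i = g x}"
  have N [measurable]: "N \<in> sets (PiM I (\<lambda>_. lborel))" unfolding N_def using I by measurable
  have "emeasure (PiM I (\<lambda>_. lborel)) N = (\<integral>\<^sup>+x. indicator N x \<partial>PiM I (\<lambda>_. lborel))"
    by simp
  also have "\<dots> = (\<integral>\<^sup>+x. (\<integral>\<^sup>+y. indicator N (x(i := y)) \<partial>lborel) \<partial>PiM J (\<lambda>_. lborel))"
    using J N by (subst J(1), subst product_nn_integral_insert) auto
  also have "\<dots> \<le> (\<integral>\<^sup>+x. (\<integral>\<^sup>+y. indicator {g x} y \<partial>lborel) \<partial>PiM J (\<lambda>_. lborel))"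
    by (intro nn_integral_mono) (auto simp: N_def indep split: split_indicator)
  also have "\<dots> = 0" by simp
  finally have "emeasure (PiM I (\<lambda>_. lborel)) N = 0" by simp
  from AE_I[OF _ this N, of "\<lambda>x. x i \<noteq> g x"] show ?thesis by (simp add: N_def)
qed

section \<open>The unsorted map, its branches and the regular points\<close>

text \<open>Here \<open>n\<close> stands for a + b, so the second assumption is b \<ge> 2; it leaves
  at least one index outside every set of a + 1 indices.\<close>

locale selmer =
  fixes a n :: nat
  assumes a_pos: "1 \<le> a" and a_less: "a + 2 \<le> n"
begin

abbreviation M :: "(nat \<Rightarrow> real) measure" where "M \<equiv> PiM {..<n} (\<lambda>_. lborel)"

definition orthant :: "(nat \<Rightarrow> real) set" where
  "orthant = {x \<in> space M. \<forall>i<n. 0 \<le> x i}"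

text \<open>With ties, \<open>small x\<close> may have more than \<open>a\<close> elements; this happens only on a null set.\<close>

definition small :: "(nat \<Rightarrow> real) \<Rightarrow> nat set" where
  "small x = {i \<in> {..<n}. card {j \<in> {..<n}. x j < x i} < a}"

text \<open>When \<open>J\<close> consists of the a smallest coordinates, the maximum over
  \<open>J\<close> is the a-th smallest one. The coordinates in \<open>J\<close> are untouched, so
  this maximum can be recovered from the image, which makes \<open>unshear J\<close> the
  inverse.\<close>

definition shear :: "nat set \<Rightarrow> (nat \<Rightarrow> real) \<Rightarrow> nat \<Rightarrow> real" where
  "shear J x = (\<lambda>i. if i \<in> {..<n} - J then x i - (MAX j\<in>J. x j) else x i)"

definition unshear :: "nat set \<Rightarrow> (nat \<Rightarrow> real) \<Rightarrow> nat \<Rightarrow> real" where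
  "unshear J x = (\<lambda>i. if i \<in> {..<n} - J then x i + (MAX j\<in>J. x j) else x i)"

definition step :: "(nat \<Rightarrow> real) \<Rightarrow> nat \<Rightarrow> real" where
  "step x = shear (small x) x"

text \<open>One condition that serves three purposes: empty \<open>K\<close> gives nonzero
  coordinates, singletons give distinct coordinates, and sets of a + 1 indices give nonzero limits
  outside the set.\<close>

definition regular :: "(nat \<Rightarrow> real) \<Rightarrow> bool" where
  "regular x \<longleftrightarrow> (\<forall>K \<subseteq> {..<n}. \<forall>i \<in> {..<n} - K. x i \<noteq> sum x K)"

definition branches :: "nat set set" where
  "branches = {J. J \<subseteq> {..<n} \<and> card J = a}"

lemma finite_branches: "finite branches"
  by (rule finite_subset[of _ "Pow {..<n}"]) (auto simp: branches_def)

lemma branchD: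
  assumes "J \<in> branches"
  shows "J \<subseteq> {..<n}" "card J = a" "finite J" "J \<noteq> {}"
  using assms a_pos by (auto simp: branches_def intro: finite_subset card_ge_0_finite)

lemma unshear_shear: "unshear J (shear J x) = x" if "J \<noteq> {}" for J x
proof -
  have "(MAX j\<in>J. shear J x j) = (MAX j\<in>J. x j)"
    by (intro arg_cong[where f = Max] image_cong) (auto simp: shear_def)
  then show ?thesis by (auto simp: unshear_def shear_def fun_eq_iff)
qed

lemma regular_nonzero: "regular x \<Longrightarrow> i < n \<Longrightarrow> x i \<noteq> 0"
  unfolding regular_def by (auto dest: spec[of _ "{}"])

lemma regular_inj: "regular x \<Longrightarrow> inj_on x {..<n}"
proof (rule inj_onI, rule ccontr)
  fix i j assume "regular x" "i \<in> {..<n}" "j \<in> {..<n}" "x i = x j" "i \<noteq> j"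
  then show False unfolding regular_def by (auto dest!: spec[of _ "{j}"])
qed

lemma small_subset: "small x \<subseteq> {..<n}"
  by (auto simp: small_def)

lemma small_below:
  assumes "j \<in> small x" "i \<in> {..<n} - small x"
  shows "x j \<le> x i"
proof (rule ccontr)
  assume "\<not> x j \<le> x i"
  then have "card {k \<in> {..<n}. x k < x i} \<le> card {k \<in> {..<n}. x k < x j}"
    by (intro card_mono) auto
  then show False using assms by (auto simp: small_def)
qed

text \<open>For \<open>i\<close> in \<open>J\<close> the indices strictly below lie in
  \<open>J - {i}\<close>, fewer than a of them; for \<open>i\<close> outside \<open>J\<close>
  distinctness puts all of \<open>J\<close> strictly below.\<close>

lemma small_unique:
  assumes inj: "inj_on x {..<n}" and J: "J \<in> branches"
    and le: "\<And>i j. j \<in> J \<Longrightarrow> i \<in> {..<n} - J \<Longrightarrow> x j \<le> x i"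
  shows "small x = J"
proof -
  note J = branchD[OF J]
  have "i \<in> small x" if i: "i \<in> J" for i
  proof -
    have "{j \<in> {..<n}. x j < x i} \<subseteq> J - {i}" using le[OF i] by force
    then have "card {j \<in> {..<n}. x j < x i} \<le> card (J - {i})" using J by (intro card_mono) auto
    also have "\<dots> < a" using J i a_pos by auto
    finally show ?thesis using J i by (auto simp: small_def)
  qed
  moreover have "i \<notin> small x" if i: "i \<in> {..<n} - J" for i
  proof -
    have "x j < x i" if "j \<in> J" for j
      using le[OF that i] inj i that J by (metis DiffD1 DiffD2 inj_onD order_less_le subsetD)
    then have "J \<subseteq> {j \<in> {..<n}. x j < x i}" using J by auto
    then have "card J \<le> card {j \<in> {..<n}. x j < x i}" by (intro card_mono) auto
    then show ?thesis using J by (auto simp: small_def)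
  qed
  ultimately show ?thesis using J small_subset by blast
qed

lemma lowest_exists:
  assumes "k \<le> n"
  obtains J where "J \<subseteq> {..<n}" "card J = k" "\<And>i j. j \<in> J \<Longrightarrow> i \<in> {..<n} - J \<Longrightarrow> (x::nat\<Rightarrow>real) j \<le> x i"
proof
  \<comment> \<open>The first \<open>k\<close> indices in order of value; ties may be broken in any
    way.\<close>
  define l where "l = sort_key x [0..<n]"
  have l: "distinct l" "set l = {..<n}" "length l = n" "sorted (map x l)"
    by (auto simp: l_def)
  show "set (take k l) \<subseteq> {..<n}" using l by (metis set_take_subset)
  show "card (set (take k l)) = k" using l assms by (simp add: distinct_card)
  fix i j assume ij: "j \<in> set (take k l)" "i \<in> {..<n} - set (take k l)"
  then have "i \<in> set (drop k l)" using l by (metis Diff_iff Un_iff append_take_drop_id set_append)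
  moreover have "sorted (map x (take k l) @ map x (drop k l))"
    using l by (metis append_take_drop_id map_append)
  ultimately show "x j \<le> x i" using ij by (auto simp: sorted_append)
qed

lemma small_branch:
  assumes "regular x"
  shows "small x \<in> branches"
proof -
  obtain J where "J \<subseteq> {..<n}" "card J = a" "\<And>i j. j \<in> J \<Longrightarrow> i \<in> {..<n} - J \<Longrightarrow> x j \<le> x i"
    using lowest_exists[of a x] a_less by auto
  then show ?thesis using small_unique[of x J] regular_inj[OF assms] by (simp add: branches_def)
qed

lemma space_M_shear: "x \<in> space M \<Longrightarrow> shear J x \<in> space M"
  by (auto simp: space_PiM PiE_def extensional_def shear_def)

text \<open>Nonnegativity of the sheared coordinates outside \<open>J\<close> says that they were at
  least the maximum over \<open>J\<close>, which identifies \<open>J\<close> as the a smallest.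
  Hence every branch is full: up to null sets it covers the whole orthant.\<close>

lemma small_eq_iff:
  assumes x: "regular x" "x \<in> space M" and J: "J \<in> branches"
  shows "x \<in> orthant \<and> small x = J \<longleftrightarrow> shear J x \<in> orthant"
proof
  assume h: "x \<in> orthant \<and> small x = J"
  have "(MAX j\<in>J. x j) \<le> x i" if "i \<in> {..<n} - J" for i
    using small_below[of _ x i] h that branchD[OF J] by simp
  then show "shear J x \<in> orthant" using h space_M_shear[OF x(2)]
    by (auto simp: orthant_def shear_def)
next
  assume h: "shear J x \<in> orthant"
  have 1: "0 \<le> x j" if "j \<in> J" for j using h branchD[OF J] that
    by (auto simp: orthant_def shear_def dest!: spec[of _ j])
  have 2: "(MAX j\<in>J. x j) \<le> x i" if "i \<in> {..<n} - J" for i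
    using h that by (auto simp: orthant_def shear_def dest!: spec[of _ i])
  have 3: "x j \<le> x i" if "j \<in> J" "i \<in> {..<n} - J" for i j
    using 2[OF that(2)] branchD[OF J] that by simp
  have "small x = J" by (rule small_unique[OF regular_inj[OF x(1)] J 3])
  \<comment> \<open>\<open>J\<close> is nonempty because a \<ge> 1;
    \<open>0 \<le> x j \<le> x i\<close> then gives nonnegativity outside \<open>J\<close> as
    well.\<close>
  moreover obtain j where "j \<in> J" using branchD[OF J] by auto
  ultimately show "x \<in> orthant \<and> small x = J"
    using x 1 3 by (force simp: orthant_def)
qed

lemma step_orthant: "regular x \<Longrightarrow> x \<in> orthant \<Longrightarrow> step x \<in> orthant"
  using small_eq_iff[of x "small x"] small_branch[of x] by (auto simp: step_def orthant_def)

section \<open>Volume preservation, null sets and measurability\<close>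

lemma MAX_measurable:
  assumes "J \<subseteq> {..<n}"
  shows "(\<lambda>x. MAX j\<in>J. x j) \<in> borel_measurable M"
  using assms by (intro borel_measurable_Max) (auto intro: measurable_component_singleton finite_subset)

lemma shear_measurable:
  assumes "J \<subseteq> {..<n}"
  shows "shear J \<in> M \<rightarrow>\<^sub>M M"
proof (rule measurable_PiM_single')
  fix i assume "i \<in> {..<n}"
  with MAX_measurable[OF assms] show "(\<lambda>x. shear J x i) \<in> M \<rightarrow>\<^sub>M lborel"
    unfolding shear_def by measurable
next
  show "shear J \<in> space M \<rightarrow> (\<Pi>\<^sub>E i\<in>{..<n}. space lborel)"
    using space_M_shear by (auto simp: space_PiM)
qed

lemma unshear_measurable:
  assumes "J \<subseteq> {..<n}"
  shows "unshear J \<in> M \<rightarrow>\<^sub>M M"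
proof (rule measurable_PiM_single')
  fix i assume "i \<in> {..<n}"
  with MAX_measurable[OF assms] show "(\<lambda>x. unshear J x i) \<in> M \<rightarrow>\<^sub>M lborel"
    unfolding unshear_def by measurable
next
  show "unshear J \<in> space M \<rightarrow> (\<Pi>\<^sub>E i\<in>{..<n}. space lborel)"
    by (auto simp: space_PiM PiE_def extensional_def unshear_def)
qed

text \<open>The amount subtracted outside \<open>J\<close> depends only on the coordinates in
  \<open>J\<close>, so the affine substitution applies with factor 1.\<close>

lemma nn_integral_shear:
  assumes J: "J \<in> branches" and f: "f \<in> borel_measurable M"
  shows "(\<integral>\<^sup>+x. f (shear J x) \<partial>M) = (\<integral>\<^sup>+x. f x \<partial>M)"
proof -
  have "(\<integral>\<^sup>+x. f x \<partial>M) = ennreal (\<bar>1\<bar> ^ card ({..<n} - J)) *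
     (\<integral>\<^sup>+x. f (\<lambda>i. if i \<in> {..<n} - J then 1 * x i + - (MAX j\<in>J. x j) else x i) \<partial>M)"
  proof (rule nn_integral_PiM_affine[OF _ _ _ _ _ f])
    fix x y :: "nat \<Rightarrow> real"
    assume "\<And>i. i \<notin> {..<n} - J \<Longrightarrow> x i = y i"
    then have "x ` J = y ` J" by (intro image_cong) auto
    then show "- (MAX j\<in>J. x j) = - (MAX j\<in>J. y j)" by simp
  qed (use MAX_measurable[OF branchD(1)[OF J]] in auto)
  moreover have "(\<lambda>i. if i \<in> {..<n} - J then 1 * x i + - (MAX j\<in>J. x j) else x i) = shear J x" for x
    by (auto simp: shear_def)
  ultimately show ?thesis by simp
qed

lemma AE_shear:
  assumes J: "J \<in> branches" and P: "AE x in M. P x"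
  shows "AE x in M. P (shear J x)"
proof -
  obtain N where N: "N \<in> null_sets M" "{x \<in> space M. \<not> P x} \<subseteq> N"
    using P by (auto elim!: AE_E)
  have [measurable]: "N \<in> sets M" using N by auto
  let ?N = "shear J -` N \<inter> space M"
  have sets: "?N \<in> sets M" using shear_measurable[OF branchD(1)[OF J]] by measurable
  have "emeasure M ?N = (\<integral>\<^sup>+x. indicator ?N x \<partial>M)" using sets by simp
  also have "\<dots> = (\<integral>\<^sup>+x. indicator N (shear J x) \<partial>M)"
    by (intro nn_integral_cong) (auto split: split_indicator)
  also have "\<dots> = 0" using N by (subst nn_integral_shear[OF J]) auto
  finally show ?thesis
    using N space_M_shear by (intro AE_I[of _ _ ?N]) (auto simp: sets)
qed

text \<open>Only finitely many hyperplanes are excluded, and \<open>i\<close> outside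
  \<open>K\<close> makes each of them a graph over the remaining coordinates.\<close>

lemma AE_regular: "AE x in M. regular x"
proof -
  have "AE x in M. x i \<noteq> sum x K" if "K \<subseteq> {..<n}" "i \<in> {..<n} - K" for K i
  proof (rule AE_PiM_neq)
    show "sum (x(i := y)) K = sum x K" for x :: "nat \<Rightarrow> real" and y
      using that by (intro sum.cong) auto
    show "(\<lambda>x. sum x K) \<in> borel_measurable M"
      using that by (intro borel_measurable_sum) (auto intro: measurable_component_singleton)
  qed (use that in auto)
  then have "AE x in M. \<forall>K \<in> Pow {..<n}. \<forall>i \<in> {..<n} - K. x i \<noteq> sum x K"
    by (simp add: AE_ball_countable countable_finite)
  then show ?thesis by eventually_elim (auto simp: regular_def)
qed

text \<open>At regular points \<open>step\<close> agrees with one of finitely many shears, and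
  preimages of null sets under these are null.\<close>

lemma AE_step:
  assumes P: "AE x in M. P x"
  shows "AE x in M. P (step x)"
proof -
  have "AE x in M. \<forall>J \<in> branches. P (shear J x)"
    using AE_shear[OF _ P] finite_branches by (simp add: AE_ball_countable countable_finite)
  with AE_regular show ?thesis
    by eventually_elim (auto simp: step_def dest: small_branch)
qed

lemma AE_regular_orbit: "AE x in M. \<forall>k. regular ((step ^^ k) x)"
proof -
  have "AE x in M. regular ((step ^^ k) x)" for k
  proof (induction k)
    case 0 then show ?case using AE_regular by simp
  next
    case (Suc k)
    from AE_step[OF this] show ?case by (simp add: funpow_swap1)
  qed
  then show ?thesis by (simp add: AE_all_countable)
qed

lemma small_measurable [measurable]: "small \<in> M \<rightarrow>\<^sub>M count_space (Pow {..<n})"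
proof -
  have "small -` {J} \<inter> space M \<in> sets M" if "J \<subseteq> {..<n}" for J
  proof -
    \<comment> \<open>Counting by a finite sum of measurable 0-1 functions makes the cardinality
      measurable in \<open>x\<close>.\<close>
    have card: "card {j \<in> {..<n}. x j < x i} = (\<Sum>j<n. if x j < x i then 1 else 0)" for x :: "nat \<Rightarrow> real" and i
      by (simp add: sum.If_cases Collect_conj_eq lessThan_def)
    have [measurable]: "(\<lambda>x. \<Sum>j<n. if x j < x i then 1 else 0::nat) \<in> M \<rightarrow>\<^sub>M count_space UNIV" if "i < n" for i
    proof -
      have "(\<lambda>x. \<Sum>j<n. if x j < x i then 1 else 0::nat) \<in> borel_measurable M"
        using that by (intro borel_measurable_sum measurable_If measurable_const) auto
      then show ?thesis using measurable_cong_sets[OF refl sets_borel_eq_count_space[where 'a=nat]] by blast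
    qed
    have "small -` {J} \<inter> space M = {x \<in> space M. \<forall>i\<in>{..<n}. (\<Sum>j<n. if x j < x i then 1 else 0::nat) < a \<longleftrightarrow> i \<in> J}"
      using that unfolding small_def card by auto
    also have "\<dots> \<in> sets M"
      by (intro sets.sets_Collect_finite_All) measurable
    finally show ?thesis .
  qed
  then show ?thesis
    using small_subset by (auto simp: measurable_count_space_eq2)
qed

lemma AE_small_branch: "AE x in M. small x \<in> branches"
  using AE_regular by eventually_elim (rule small_branch)

section \<open>Transport of monotone densities along the branches\<close>

text \<open>The candidates for the set of a + 1 coordinates that finally tend to 0.\<close>

definition cells :: "nat set set" where
  "cells = {K. K \<subseteq> {..<n} \<and> card K = Suc a}"

definition mu :: "((nat \<Rightarrow> real) \<Rightarrow> ennreal) \<Rightarrow> (nat \<Rightarrow> real) measure" where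
  "mu h = density M (\<lambda>x. h x * indicator orthant x)"

text \<open>This class is stable under passing to a branch, and antitonicity is what makes densities
  grow when coordinates are shrunk. Finite mass permits subtraction of measures.\<close>

definition admissible :: "((nat \<Rightarrow> real) \<Rightarrow> ennreal) \<Rightarrow> bool" where
  "admissible h \<longleftrightarrow> h \<in> borel_measurable M \<and>
     (\<forall>x \<in> orthant. \<forall>y \<in> orthant. (\<forall>i<n. x i \<le> y i) \<longrightarrow> h y \<le> h x) \<and>
     emeasure (mu h) (space M) < \<infinity>"

definition escape :: "nat \<Rightarrow> nat set \<Rightarrow> (nat \<Rightarrow> real) set" where
  "escape i K = {x \<in> space M. \<exists>j<i. \<not> small ((step ^^ j) x) \<subseteq> K}"

text \<open>The bad set, to be shown null within the orthant: off it, the sets \<open>small\<close>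
  along the orbit finally stay within one cell.\<close>

definition roaming :: "(nat \<Rightarrow> real) set" where
  "roaming = {x \<in> space M. \<forall>K \<in> cells. \<forall>k. \<exists>j\<ge>k. \<not> small ((step ^^ j) x) \<subseteq> K}"

lemma finite_cells: "finite cells"
  by (rule finite_subset[of _ "Pow {..<n}"]) (auto simp: cells_def)

lemma cellD:
  assumes "K \<in> cells"
  shows "K \<subseteq> {..<n}" "card K = Suc a" "finite K"
  using assms by (auto simp: cells_def intro: card_ge_0_finite)

lemma orthant_sets [measurable]: "orthant \<in> sets M"
  unfolding orthant_def by measurable

lemma sets_mu [simp, measurable_cong]: "sets (mu h) = sets M"
  by (simp add: mu_def)

lemma space_mu [simp]: "space (mu h) = space M"
  by (simp add: mu_def)

lemma emeasure_mu:
  assumes [measurable]: "h \<in> borel_measurable M" "A \<in> sets M"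
  shows "emeasure (mu h) A = (\<integral>\<^sup>+x. h x * indicator orthant x * indicator A x \<partial>M)"
  unfolding mu_def by (rule emeasure_density) measurable

lemma AE_mu:
  assumes [measurable]: "h \<in> borel_measurable M" and P: "AE x in M. P x"
  shows "AE x in mu h. x \<in> orthant \<and> P x"
  unfolding mu_def using P by (subst AE_density) (auto split: split_indicator elim: eventually_mono)

lemma pred_small_eq [measurable]: "Measurable.pred M (\<lambda>x. small x = J)"
proof -
  have "(\<lambda>J'. J' = J) \<in> count_space (Pow {..<n}) \<rightarrow>\<^sub>M count_space UNIV" by simp
  from measurable_compose[OF small_measurable this] show ?thesis .
qed

lemma step_measurable [measurable]: "step \<in> M \<rightarrow>\<^sub>M M"
  unfolding step_def
proof (rule measurable_compose_countable'[OF _ small_measurable])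
  show "shear J \<in> M \<rightarrow>\<^sub>M M" if "J \<in> Pow {..<n}" for J
    using that by (intro shear_measurable) simp
qed (auto intro: countable_finite)

lemma small_step_measurable [measurable]:
  "(\<lambda>x. small ((step ^^ k) x)) \<in> M \<rightarrow>\<^sub>M count_space (Pow {..<n})"
  by measurable

lemma pred_small_step_subset [measurable]:
  "Measurable.pred M (\<lambda>x. small ((step ^^ k) x) \<subseteq> K)"
proof -
  have "(\<lambda>J. J \<subseteq> K) \<in> count_space (Pow {..<n}) \<rightarrow>\<^sub>M count_space UNIV" by simp
  from measurable_compose[OF small_step_measurable this] show ?thesis .
qed

lemma escape_sets [measurable]: "escape i K \<in> sets M"
  unfolding escape_def by measurable

lemma roaming_sets [measurable]: "roaming \<in> sets M"
proof -
  have "countable cells" by (rule countable_finite[OF finite_cells])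
  then have "Measurable.pred M (\<lambda>x. \<forall>K \<in> cells. \<forall>k. \<exists>j\<ge>k. \<not> small ((step ^^ j) x) \<subseteq> K)"
    by measurable
  then show ?thesis unfolding roaming_def by measurable
qed

lemma space_M_step: "x \<in> space M \<Longrightarrow> step x \<in> space M"
  by (simp add: step_def space_M_shear)

lemma escape_0: "escape 0 K = {}"
  by (simp add: escape_def)

lemma escape_Suc:
  "escape (Suc i) K = {x \<in> space M. \<not> small x \<subseteq> K \<or> step x \<in> escape i K}"
proof -
  have "(\<exists>j<Suc i. \<not> small ((step ^^ j) x) \<subseteq> K) \<longleftrightarrow>
      \<not> small x \<subseteq> K \<or> (\<exists>j<i. \<not> small ((step ^^ j) (step x)) \<subseteq> K)" for x
    by (simp add: Ex_less_Suc2 funpow_swap1)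
  then show ?thesis by (auto simp: escape_def space_M_step)
qed

lemma step_roaming_iff: "x \<in> space M \<Longrightarrow> step x \<in> roaming \<longleftrightarrow> x \<in> roaming"
proof -
  assume x: "x \<in> space M"
  have "(\<forall>k. \<exists>j\<ge>k. \<not> small ((step ^^ j) (step x)) \<subseteq> K) \<longleftrightarrow>
      (\<forall>k. \<exists>j\<ge>k. \<not> small ((step ^^ j) x) \<subseteq> K)" for K
  proof -
    have 1: "(step ^^ j) (step x) = (step ^^ Suc j) x" for j by (simp add: funpow_swap1)
    show ?thesis unfolding 1
      by (metis Suc_le_D Suc_le_mono le_SucI)
  qed
  then show ?thesis using x by (simp add: roaming_def space_M_step)
qed

text \<open>Change of variables along \<open>shear J\<close>. The Jacobian is 1 and the branch is
  full, so the transported measure again lives on the entire orthant, with density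
  \<open>h \<circ> unshear J\<close>.\<close>

lemma emeasure_branch:
  assumes J: "J \<in> branches" and h [measurable]: "h \<in> borel_measurable M" and A [measurable]: "A \<in> sets M"
  shows "emeasure (mu h) {x \<in> space M. small x = J \<and> step x \<in> A} = emeasure (mu (h \<circ> unshear J)) A"
proof -
  note [measurable] = shear_measurable[OF branchD(1)[OF J]] unshear_measurable[OF branchD(1)[OF J]]
  have B: "{x \<in> space M. small x = J \<and> step x \<in> A} \<in> sets M"
    by measurable
  have "emeasure (mu h) {x \<in> space M. small x = J \<and> step x \<in> A} =
     (\<integral>\<^sup>+x. h x * indicator orthant x * indicator {x \<in> space M. small x = J \<and> step x \<in> A} x \<partial>M)"
    by (rule emeasure_mu[OF h B])
  also have "\<dots> = (\<integral>\<^sup>+x. (h \<circ> unshear J) (shear J x) * indicator orthant (shear J x) * indicator A (shear J x) \<partial>M)"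
  proof (rule nn_integral_cong_AE)
    from AE_regular show "AE x in M. h x * indicator orthant x * indicator {x \<in> space M. small x = J \<and> step x \<in> A} x =
      (h \<circ> unshear J) (shear J x) * indicator orthant (shear J x) * indicator A (shear J x)"
      using AE_space
    proof eventually_elim
      case (elim x)
      have "x \<in> orthant \<and> small x = J \<longleftrightarrow> shear J x \<in> orthant"
        by (rule small_eq_iff[OF elim J])
      then show ?case using elim branchD(4)[OF J]
        by (auto simp: unshear_shear step_def split: split_indicator)
    qed
  qed
  also have "\<dots> = (\<integral>\<^sup>+x. (h \<circ> unshear J) x * indicator orthant x * indicator A x \<partial>M)"
    by (rule nn_integral_shear[OF J]) measurable
  also have "\<dots> = emeasure (mu (h \<circ> unshear J)) A"
    by (rule emeasure_mu[symmetric]) measurable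
  finally show ?thesis .
qed

text \<open>The inverse branch maps the orthant to itself and is monotone in the coordinatewise
  order, so composing with it keeps \<open>h\<close> antitone. The new mass is the
  \<open>mu h\<close> mass of a subset, hence finite.\<close>

lemma admissible_branch:
  assumes J: "J \<in> branches" and h: "admissible h"
  shows "admissible (h \<circ> unshear J)"
  unfolding admissible_def
proof (intro conjI ballI impI)
  have hm: "h \<in> borel_measurable M" using h by (simp add: admissible_def)
  show "h \<circ> unshear J \<in> borel_measurable M"
    using measurable_comp[OF unshear_measurable[OF branchD(1)[OF J]] hm] by simp
  have "emeasure (mu (h \<circ> unshear J)) (space M) = emeasure (mu h) {x \<in> space M. small x = J \<and> step x \<in> space M}"
    by (rule emeasure_branch[OF J hm sets.top, symmetric])
  also have "\<dots> \<le> emeasure (mu h) (space M)"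
    using emeasure_space[of "mu h"] by simp
  also have "\<dots> < \<infinity>" using h by (simp add: admissible_def)
  finally show "emeasure (mu (h \<circ> unshear J)) (space M) < \<infinity>" .
next
  fix x y assume xy: "x \<in> orthant" "y \<in> orthant" "\<forall>i<n. x i \<le> y i"
  note JD = branchD[OF J]
  have le: "(MAX j\<in>J. x j) \<le> (MAX j\<in>J. y j)"
    using JD xy by (intro Max.boundedI) (auto intro!: Max_ge_iff[THEN iffD2])
  have nonneg: "0 \<le> (MAX j\<in>J. x j)" if "x \<in> orthant" for x :: "nat \<Rightarrow> real"
  proof -
    obtain j where "j \<in> J" using JD by auto
    then show ?thesis using that JD by (intro Max_ge_iff[THEN iffD2]) (auto simp: orthant_def)
  qed
  have un: "unshear J x \<in> orthant" if "x \<in> orthant" for x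
    using that nonneg[OF that] by (auto simp: orthant_def unshear_def space_PiM PiE_def extensional_def)
  have "\<forall>i<n. unshear J x i \<le> unshear J y i"
    using xy le by (auto simp: unshear_def intro: add_mono)
  then show "(h \<circ> unshear J) y \<le> (h \<circ> unshear J) x"
    using h un[OF xy(1)] un[OF xy(2)] by (simp add: admissible_def)
qed

lemma emeasure_branch_sum:
  assumes h [measurable]: "h \<in> borel_measurable M" and A [measurable]: "A \<in> sets M"
  shows "emeasure (mu h) A = (\<Sum>J\<in>branches. emeasure (mu h) {x \<in> A. small x = J})"
proof -
  have S: "{x \<in> A. small x = J} \<in> sets M" for J
  proof -
    have "{x \<in> A. small x = J} = A \<inter> {x \<in> space M. small x = J}" using sets.sets_into_space[OF A] by auto
    then show ?thesis by simp
  qed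
  have "emeasure (mu h) A = emeasure (mu h) (\<Union>J\<in>branches. {x \<in> A. small x = J})"
  proof (rule emeasure_eq_AE)
    show "AE x in mu h. x \<in> A \<longleftrightarrow> x \<in> (\<Union>J\<in>branches. {x \<in> A. small x = J})"
      using AE_mu[OF h AE_small_branch] by eventually_elim auto
  qed (use A S finite_branches in auto)
  also have "\<dots> = (\<Sum>J\<in>branches. emeasure (mu h) {x \<in> A. small x = J})"
    using S finite_branches by (intro sum_emeasure[symmetric]) (auto simp: disjoint_family_on_def)
  finally show ?thesis .
qed

text \<open>The restart argument, by induction on time and splitting by the first set
  \<open>J\<close>. If \<open>J\<close> is not within \<open>K\<close>, the escape has just occurred
  and the assumed bound applies to the transported measure on the whole space; otherwise the
  induction hypothesis applies to that measure. Both uses require the bound for all admissible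
  densities at once.\<close>

lemma roaming_escape_le:
  assumes le: "\<And>h. admissible h \<Longrightarrow> emeasure (mu h) roaming \<le> r * emeasure (mu h) (space M)"
    and h: "admissible h"
  shows "emeasure (mu h) (roaming \<inter> escape i K) \<le> r * emeasure (mu h) (escape i K)"
  using h
proof (induction i arbitrary: h)
  case 0
  then show ?case by (simp add: escape_0)
next
  case (Suc i)
  have hm: "h \<in> borel_measurable M" using Suc.prems by (simp add: admissible_def)
  have "emeasure (mu h) {x \<in> roaming \<inter> escape (Suc i) K. small x = J}
    \<le> r * emeasure (mu h) {x \<in> escape (Suc i) K. small x = J}" if J: "J \<in> branches" for J
  proof (cases "J \<subseteq> K")
    case False
    have "{x \<in> roaming \<inter> escape (Suc i) K. small x = J} = {x \<in> space M. small x = J \<and> step x \<in> roaming}"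
      using False step_roaming_iff by (auto simp: escape_Suc)
    moreover have "{x \<in> escape (Suc i) K. small x = J} = {x \<in> space M. small x = J \<and> step x \<in> space M}"
      using False space_M_step by (auto simp: escape_Suc)
    ultimately show ?thesis
      using le[OF admissible_branch[OF J Suc.prems]] by (simp only: emeasure_branch[OF J hm] roaming_sets sets.top)
  next
    case True
    have "{x \<in> roaming \<inter> escape (Suc i) K. small x = J} = {x \<in> space M. small x = J \<and> step x \<in> roaming \<inter> escape i K}"
      using True step_roaming_iff by (auto simp: escape_Suc)
    moreover have "{x \<in> escape (Suc i) K. small x = J} = {x \<in> space M. small x = J \<and> step x \<in> escape i K}"
      using True by (auto simp: escape_Suc)
    ultimately show ?thesis
      using Suc.IH[OF admissible_branch[OF J Suc.prems]]
      by (simp only: emeasure_branch[OF J hm] roaming_sets escape_sets sets.Int)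
  qed
  then show ?case
    by (simp only: emeasure_branch_sum[OF hm, of "roaming \<inter> escape (Suc i) K"] emeasure_branch_sum[OF hm, of "escape (Suc i) K"]
       roaming_sets escape_sets sets.Int sum_distrib_left sum_mono)
qed

text \<open>A roaming orbit leaves every cell at some time; continuity from below removes the time
  bound \<open>i\<close>.\<close>

lemma roaming_le_escapes:
  assumes le: "\<And>h. admissible h \<Longrightarrow> emeasure (mu h) roaming \<le> r * emeasure (mu h) (space M)"
    and h: "admissible h" and K: "K \<in> cells"
  shows "emeasure (mu h) roaming \<le> r * emeasure (mu h) (\<Union>i. escape i K)"
proof -
  have mono: "escape i K \<subseteq> escape j K" if "i \<le> j" for i j
    using that unfolding escape_def by (blast intro: less_le_trans)
  have "roaming \<subseteq> (\<Union>i. escape i K)"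
    using K unfolding roaming_def escape_def by (blast intro: lessI)
  then have "emeasure (mu h) roaming = emeasure (mu h) (\<Union>i. roaming \<inter> escape i K)"
    by (intro arg_cong[where f = "emeasure (mu h)"]) auto
  also have "\<dots> = (SUP i. emeasure (mu h) (roaming \<inter> escape i K))"
    using mono by (intro SUP_emeasure_incseq[symmetric]) (auto simp: incseq_def)
  also have "\<dots> \<le> r * emeasure (mu h) (\<Union>i. escape i K)"
  proof (rule SUP_least)
    fix i
    have "emeasure (mu h) (roaming \<inter> escape i K) \<le> r * emeasure (mu h) (escape i K)"
      by (rule roaming_escape_le[OF le h])
    also have "\<dots> \<le> r * emeasure (mu h) (\<Union>i. escape i K)"
      by (intro mult_left_mono emeasure_mono) auto
    finally show "emeasure (mu h) (roaming \<inter> escape i K) \<le> r * emeasure (mu h) (\<Union>i. escape i K)" .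
  qed
  finally show ?thesis .
qed

section \<open>A trapping region with a fixed share of the mass\<close>

definition trap :: "nat set \<Rightarrow> (nat \<Rightarrow> real) set" where
  "trap K = {x \<in> orthant. \<forall>i \<in> {..<n} - K. sum x K < x i}"

text \<open>A coordinate outside \<open>K\<close> exceeds all a + 1 coordinates in \<open>K\<close>,
  so it is not among the a smallest.\<close>

lemma trap_small:
  assumes K: "K \<in> cells" and x: "x \<in> trap K"
  shows "small x \<subseteq> K"
proof (rule ccontr)
  assume "\<not> small x \<subseteq> K"
  then obtain i where i: "i \<in> small x" "i \<in> {..<n} - K" using small_subset by auto
  have "x l < x i" if "l \<in> K" for l
  proof -
    have "x l \<le> sum x K" using x cellD[OF K] that by (intro member_le_sum) (auto simp: trap_def orthant_def)
    also have "\<dots> < x i" using x i by (auto simp: trap_def)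
    finally show ?thesis .
  qed
  then have "K \<subseteq> {j \<in> {..<n}. x j < x i}" using cellD[OF K] by auto
  then have "card K \<le> card {j \<in> {..<n}. x j < x i}" by (intro card_mono) auto
  then show False using i cellD[OF K] by (auto simp: small_def)
qed

text \<open>Exactly one index of \<open>K\<close> lies outside \<open>small x\<close>, so the sum
  over \<open>K\<close> drops by the subtracted maximum exactly once, just like each coordinate
  outside \<open>K\<close>. Hence \<open>x i - sum x K\<close> is invariant for such
  \<open>i\<close>.\<close>

lemma step_cell:
  assumes K: "K \<in> cells" and x: "regular x" and sub: "small x \<subseteq> K"
  shows "sum (step x) K = sum x K - (MAX j\<in>small x. x j)"
    and "\<And>i. i \<in> {..<n} - K \<Longrightarrow> step x i = x i - (MAX j\<in>small x. x j)"
proof -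
  note J = branchD[OF small_branch[OF x]] and K = cellD[OF K]
  have "card (K - small x) = 1" using J K sub by (simp add: card_Diff_subset)
  then obtain l where l: "K - small x = {l}" by (auto simp: card_1_singleton_iff)
  have Ksplit: "K = insert l (small x)" "l \<notin> small x" "l < n" using l sub K by auto
  have "sum (step x) (small x) = sum x (small x)"
    by (intro sum.cong) (auto simp: step_def shear_def)
  then show "sum (step x) K = sum x K - (MAX j\<in>small x. x j)"
    unfolding Ksplit(1) using J Ksplit by (simp add: step_def shear_def)
  show "\<And>i. i \<in> {..<n} - K \<Longrightarrow> step x i = x i - (MAX j\<in>small x. x j)"
    using sub by (auto simp: step_def shear_def)
qed

lemma trap_step:
  assumes K: "K \<in> cells" and x: "regular x" "x \<in> trap K"
  shows "step x \<in> trap K"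
  using step_cell[OF K x(1) trap_small[OF K x(2)]] step_orthant[OF x(1)] x(2)
  by (auto simp: trap_def)

lemma trap_not_escape:
  assumes K: "K \<in> cells" and x: "\<forall>k. regular ((step ^^ k) x)" "x \<in> trap K"
  shows "x \<notin> escape i K"
proof -
  have "(step ^^ k) x \<in> trap K" for k
    by (induction k) (use x trap_step[OF K] in auto)
  then show ?thesis using trap_small[OF K] by (auto simp: escape_def)
qed

definition lowest :: "nat set \<Rightarrow> (nat \<Rightarrow> real) set" where
  "lowest K = {x \<in> orthant. \<forall>i \<in> {..<n} - K. \<forall>l \<in> K. x l \<le> x i}"

text \<open>The volume factor of scaling a + 1 coordinates by 1 / (a + 2).\<close>

definition ratio :: real where
  "ratio = (1 / (real a + 2)) ^ Suc a"

lemma trap_sets [measurable]: "K \<in> cells \<Longrightarrow> trap K \<in> sets M"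
proof -
  assume K: "K \<in> cells"
  have [measurable]: "(\<lambda>x. sum x K) \<in> borel_measurable M"
    using cellD[OF K] by (intro borel_measurable_sum) (auto intro: measurable_component_singleton)
  have "trap K = {x \<in> space M. x \<in> orthant \<and> (\<forall>i \<in> {..<n} - K. sum x K < x i)}"
    by (auto simp: trap_def orthant_def)
  also have "\<dots> \<in> sets M" by measurable
  finally show ?thesis .
qed

lemma lowest_sets [measurable]: "K \<in> cells \<Longrightarrow> lowest K \<in> sets M"
proof -
  assume K: "K \<in> cells"
  have 1: "{x \<in> space M. x l \<le> x i} \<in> sets M" if "i \<in> {..<n}" "l \<in> {..<n}" for i l
  proof -
    have [measurable]: "(\<lambda>x. x i) \<in> borel_measurable M" "(\<lambda>x. x l) \<in> borel_measurable M"
      using that by (auto intro: measurable_component_singleton)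
    show ?thesis by measurable
  qed
  have "lowest K = orthant \<inter> {x \<in> space M. \<forall>i \<in> {..<n} - K. \<forall>l \<in> K. x l \<le> x i}"
    by (auto simp: lowest_def orthant_def)
  also have "\<dots> \<in> sets M"
    using cellD[OF K] by (intro sets.Int orthant_sets sets.sets_Collect_finite_All 1) auto
  finally show ?thesis .
qed

text \<open>Shrinking the cell coordinates carries lowest points into the trap; an admissible density can
  only increase under this map.\<close>

lemma trap_ge_lowest:
  assumes K: "K \<in> cells" and h: "admissible h"
  shows "ennreal ratio * emeasure (mu h) (lowest K) \<le> emeasure (mu h) (trap K)"
proof -
  have hm [measurable]: "h \<in> borel_measurable M" using h by (simp add: admissible_def)
  note KD = cellD[OF K]
  note [measurable] = trap_sets[OF K] lowest_sets[OF K]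
  \<comment> \<open>Chosen so that \<open>e * (real a + 1) < 1\<close>: each of the a + 1 cell
    coordinates is at most \<open>x i\<close> for \<open>i\<close> outside the cell, so their
    shrunken sum stays below \<open>x i\<close>.\<close>
  define e where "e = 1 / (real a + 2)"
  have e: "0 < e" "e \<le> 1" "e * (real a + 1) < 1" by (auto simp: e_def field_simps)
  define S where "S x = (\<lambda>i. if i \<in> K then e * x i + 0 else x i)" for x :: "nat \<Rightarrow> real"
  have S_trap: "S x \<in> trap K \<and> S x \<in> orthant \<and> h x \<le> h (S x)" if x: "x \<in> lowest K" "regular x" for x
  proof -
    have nn: "0 \<le> x i" if "i < n" for i using x that by (auto simp: lowest_def orthant_def)
    have So: "S x \<in> orthant"
      using x nn e KD by (auto simp: lowest_def orthant_def S_def space_PiM PiE_def extensional_def)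
    have "sum (S x) K < S x i" if i: "i \<in> {..<n} - K" for i
    proof -
      have "0 < x i" using nn[of i] regular_nonzero[OF x(2), of i] i by auto
      have "sum (S x) K = e * sum x K" by (simp add: S_def sum_distrib_left)
      also have "\<dots> \<le> e * (\<Sum>l\<in>K. x i)"
        using x i e by (intro mult_left_mono sum_mono) (auto simp: lowest_def)
      also have "\<dots> = (e * (real a + 1)) * x i" using KD by simp
      also have "\<dots> < 1 * x i" using e \<open>0 < x i\<close> by (intro mult_strict_right_mono)
      finally show ?thesis using i by (simp add: S_def)
    qed
    moreover have "\<forall>i<n. S x i \<le> x i"
      using nn e by (auto simp: S_def mult_left_le_one_le)
    ultimately show ?thesis using So h x by (auto simp: trap_def admissible_def lowest_def)
  qed
  have "ennreal ratio * emeasure (mu h) (lowest K) =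
      ennreal ratio * (\<integral>\<^sup>+x. h x * indicator orthant x * indicator (lowest K) x \<partial>M)"
    by (simp add: emeasure_mu)
  also have "\<dots> \<le> ennreal ratio * (\<integral>\<^sup>+x. h (S x) * indicator orthant (S x) * indicator (trap K) (S x) \<partial>M)"
  proof (intro mult_left_mono nn_integral_mono_AE)
    show "AE x in M. h x * indicator orthant x * indicator (lowest K) x
       \<le> h (S x) * indicator orthant (S x) * indicator (trap K) (S x)"
      using AE_regular by eventually_elim (use S_trap in \<open>auto split: split_indicator\<close>)
  qed simp
  also have "\<dots> = (\<integral>\<^sup>+x. h x * indicator orthant x * indicator (trap K) x \<partial>M)"
  proof -
    have "(\<integral>\<^sup>+x. h x * indicator orthant x * indicator (trap K) x \<partial>M) = ennreal (\<bar>e\<bar> ^ card K) *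
      (\<integral>\<^sup>+x. (\<lambda>x. h x * indicator orthant x * indicator (trap K) x) (\<lambda>i. if i \<in> K then e * x i + 0 else x i) \<partial>M)"
      by (rule nn_integral_PiM_affine) (use KD e in auto)
    then show ?thesis using e KD by (simp add: S_def ratio_def e_def)
  qed
  also have "\<dots> = emeasure (mu h) (trap K)" by (simp add: emeasure_mu)
  finally show ?thesis .
qed

lemma cells_cover:
  assumes h: "admissible h"
  shows "emeasure (mu h) (space M) \<le> (\<Sum>K\<in>cells. emeasure (mu h) (lowest K))"
proof -
  have hm [measurable]: "h \<in> borel_measurable M" using h by (simp add: admissible_def)
  have "x \<in> (\<Union>K\<in>cells. lowest K)" if "x \<in> orthant" for x
  proof -
    obtain K where "K \<subseteq> {..<n}" "card K = Suc a" "\<And>i j. j \<in> K \<Longrightarrow> i \<in> {..<n} - K \<Longrightarrow> x j \<le> x i"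
      using lowest_exists[of "Suc a" x] a_less by auto
    then show ?thesis using that by (auto simp: cells_def lowest_def intro!: bexI[of _ K])
  qed
  then have "emeasure (mu h) (space M) \<le> emeasure (mu h) (\<Union>K\<in>cells. lowest K)"
    using AE_mu[OF hm, of "\<lambda>_. True"] finite_cells
    by (intro emeasure_mono_AE) (auto elim: eventually_mono)
  also have "\<dots> \<le> (\<Sum>K\<in>cells. emeasure (mu h) (lowest K))"
    using finite_cells by (intro emeasure_subadditive_finite) auto
  finally show ?thesis .
qed

section \<open>Geometric decay of the roaming mass\<close>

lemma ratio_pos: "0 < ratio"
  by (simp add: ratio_def)

lemma ratio_le_1: "ratio \<le> 1"
  unfolding ratio_def by (intro power_le_one) auto

lemma card_cells_pos: "0 < card cells"
proof -
  have "{..<Suc a} \<in> cells" using a_less by (auto simp: cells_def)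
  then show ?thesis using finite_cells by (auto simp: card_gt_0_iff)
qed

text \<open>By pigeonhole some \<open>lowest K\<close> carries at least 1 /
  \<open>card cells\<close> of the mass, and \<open>trap K\<close> at least \<open>ratio\<close>
  times as much as that; this is what may remain outside the trap.\<close>

definition contraction :: real where
  "contraction = 1 - ratio / card cells"

lemma contraction_nonneg: "0 \<le> contraction" and contraction_less_1: "contraction < 1"
proof -
  have "ratio / card cells \<le> 1 / 1"
    using ratio_le_1 ratio_pos card_cells_pos by (intro frac_le) auto
  then show "0 \<le> contraction" by (simp add: contraction_def)
  show "contraction < 1" using ratio_pos card_cells_pos by (simp add: contraction_def)
qed

lemma heavy_cell:
  assumes h: "admissible h"
  obtains K where "K \<in> cells"
    "measure (mu h) (space M) / card cells \<le> measure (mu h) (lowest K)"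
proof -
  have fin: "emeasure (mu h) (space M) < \<infinity>" using h by (simp add: admissible_def)
  then interpret finite_measure "mu h" by (intro finite_measureI) auto
  have "\<exists>K\<in>cells. measure (mu h) (space M) / card cells \<le> measure (mu h) (lowest K)"
  proof (rule ccontr)
    assume "\<not> ?thesis"
    then have "(\<Sum>K\<in>cells. measure (mu h) (lowest K)) < (\<Sum>K\<in>cells. measure (mu h) (space M) / card cells)"
      using card_cells_pos finite_cells by (intro sum_strict_mono) (auto simp: not_le)
    also have "\<dots> = measure (mu h) (space M)" using card_cells_pos by simp
    finally have "(\<Sum>K\<in>cells. measure (mu h) (lowest K)) < measure (mu h) (space M)" .
    moreover have "ennreal (measure (mu h) (space M)) \<le> ennreal (\<Sum>K\<in>cells. measure (mu h) (lowest K))"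
      using cells_cover[OF h] by (simp add: emeasure_eq_measure sum_nonneg)
    then have "measure (mu h) (space M) \<le> (\<Sum>K\<in>cells. measure (mu h) (lowest K))"
      by (simp add: sum_nonneg)
    ultimately show False by simp
  qed
  then show thesis using that by blast
qed

text \<open>For the heaviest cell, almost no point of its trap ever escapes, so up to a null set the
  escaping points lie in the complement of the trap.\<close>

lemma escapes_le:
  assumes h: "admissible h"
  obtains K where "K \<in> cells"
    "emeasure (mu h) (\<Union>i. escape i K) \<le> ennreal contraction * emeasure (mu h) (space M)"
proof -
  have hm: "h \<in> borel_measurable M" using h by (simp add: admissible_def)
  have fin: "emeasure (mu h) (space M) < \<infinity>" using h by (simp add: admissible_def)
  then interpret finite_measure "mu h" by (intro finite_measureI) auto
  obtain K where K: "K \<in> cells" "measure (mu h) (space M) / card cells \<le> measure (mu h) (lowest K)"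
    using heavy_cell[OF h] .
  have "ennreal (ratio * measure (mu h) (lowest K)) \<le> ennreal (measure (mu h) (trap K))"
    using trap_ge_lowest[OF K(1) h] ratio_pos by (simp add: emeasure_eq_measure ennreal_mult)
  then have trap: "ratio * measure (mu h) (lowest K) \<le> measure (mu h) (trap K)" by simp
  have "AE x in mu h. x \<notin> (\<Union>i. escape i K) \<inter> trap K"
    using AE_mu[OF hm AE_regular_orbit] by eventually_elim (use trap_not_escape[OF K(1)] in auto)
  then have "emeasure (mu h) ((\<Union>i. escape i K) \<inter> trap K) = 0"
    using trap_sets[OF K(1)] by (intro null_setsD1 AE_iff_null_sets[THEN iffD2]) auto
  then have 0: "measure (mu h) ((\<Union>i. escape i K) \<inter> trap K) = 0"
    by (simp add: measure_def)
  have "measure (mu h) (\<Union>i. escape i K) + measure (mu h) (trap K)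
      = measure (mu h) ((\<Union>i. escape i K) \<union> trap K)"
    using 0 trap_sets[OF K(1)] by (subst finite_measure_Union') (auto simp: finite_measure_Diff' Int_commute)
  also have "\<dots> \<le> measure (mu h) (space M)"
    using bounded_measure[of "(\<Union>i. escape i K) \<union> trap K"] by simp
  finally have "measure (mu h) (\<Union>i. escape i K) \<le> measure (mu h) (space M) - ratio * measure (mu h) (lowest K)"
    using trap by simp
  also have "\<dots> \<le> measure (mu h) (space M) - ratio * (measure (mu h) (space M) / card cells)"
    using mult_left_mono[OF K(2), of ratio] ratio_pos by simp
  also have "\<dots> = contraction * measure (mu h) (space M)"
    by (simp add: contraction_def algebra_simps)
  finally have "emeasure (mu h) (\<Union>i. escape i K) \<le> ennreal contraction * emeasure (mu h) (space M)"
    using contraction_nonneg by (simp add: emeasure_eq_measure ennreal_mult[symmetric] ennreal_leI)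
  then show thesis using that K(1) by blast
qed

text \<open>Each further escape costs a factor \<open>contraction\<close>. The induction runs over
  all admissible \<open>h\<close> simultaneously, because the restart argument needs the bound for
  the transported densities; the cell \<open>K\<close> may change from stage to stage.\<close>

lemma roaming_le_power:
  assumes "admissible h"
  shows "emeasure (mu h) roaming \<le> ennreal (contraction ^ k) * emeasure (mu h) (space M)"
  using assms
proof (induction k arbitrary: h)
  case 0
  then show ?case using emeasure_space[of "mu h" roaming] by simp
next
  case (Suc k)
  obtain K where K: "K \<in> cells"
    "emeasure (mu h) (\<Union>i. escape i K) \<le> ennreal contraction * emeasure (mu h) (space M)"
    using escapes_le[OF Suc.prems] .
  have "emeasure (mu h) roaming \<le> ennreal (contraction ^ k) * emeasure (mu h) (\<Union>i. escape i K)"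
    by (rule roaming_le_escapes[OF Suc.IH Suc.prems K(1)])
  also have "\<dots> \<le> ennreal (contraction ^ k) * (ennreal contraction * emeasure (mu h) (space M))"
    using K(2) by (intro mult_left_mono) auto
  also have "\<dots> = ennreal (contraction ^ Suc k) * emeasure (mu h) (space M)"
    by (simp only: power_Suc2 ennreal_mult[OF zero_le_power[OF contraction_nonneg] contraction_nonneg] mult.assoc)
  finally show ?case .
qed

lemma roaming_null:
  assumes h: "admissible h"
  shows "emeasure (mu h) roaming = 0"
proof -
  have fin: "emeasure (mu h) (space M) < \<infinity>" using h by (simp add: admissible_def)
  then interpret finite_measure "mu h" by (intro finite_measureI) auto
  have "measure (mu h) roaming \<le> contraction ^ k * measure (mu h) (space M)" for k
  proof -
    have "ennreal (measure (mu h) roaming) \<le> ennreal (contraction ^ k * measure (mu h) (space M))"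
      using roaming_le_power[OF h, of k] contraction_nonneg
      by (simp add: emeasure_eq_measure ennreal_mult)
    then show ?thesis using contraction_nonneg by simp
  qed
  moreover have "(\<lambda>k. contraction ^ k * measure (mu h) (space M)) \<longlonglongrightarrow> 0 * measure (mu h) (space M)"
    using contraction_nonneg contraction_less_1 by (intro tendsto_mult LIMSEQ_power_zero) auto
  ultimately have "measure (mu h) roaming \<le> 0"
    by (intro LIMSEQ_le_const[where a = "measure (mu h) roaming" and x = 0]) auto
  then show ?thesis by (simp add: emeasure_eq_measure measure_le_0_iff)
qed

section \<open>Passage to Lebesgue measure on the orthant\<close>

text \<open>The bound is only from above, which makes the function antitone; restricted to the
  orthant it is the indicator of a cube, of finite mass. The constant density 1 would have infinite
  mass.\<close>

definition box_density :: "nat \<Rightarrow> (nat \<Rightarrow> real) \<Rightarrow> ennreal" where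
  "box_density R = indicator {x \<in> space M. \<forall>i<n. x i \<le> real R}"

lemma admissible_box: "admissible (box_density R)"
  unfolding admissible_def
proof (intro conjI ballI impI)
  have sets [measurable]: "{x \<in> space M. \<forall>i<n. x i \<le> real R} \<in> sets M" by measurable
  show hm: "box_density R \<in> borel_measurable M" unfolding box_density_def by measurable
  show "box_density R y \<le> box_density R x"
    if "x \<in> orthant" "y \<in> orthant" "\<forall>i<n. x i \<le> y i" for x y
    using that by (auto simp: box_density_def orthant_def split: split_indicator intro: order_trans)
  interpret product_sigma_finite "\<lambda>_::nat. lborel :: real measure" ..
  have "emeasure (mu (box_density R)) (space M) \<le> (\<integral>\<^sup>+x. indicator (\<Pi>\<^sub>E i\<in>{..<n}. {0..real R}) x \<partial>M)"
    unfolding emeasure_mu[OF hm sets.top]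
    by (intro nn_integral_mono) (auto simp: box_density_def orthant_def space_PiM split: split_indicator)
  also have "\<dots> = emeasure M (\<Pi>\<^sub>E i\<in>{..<n}. {0..real R})"
    by (intro nn_integral_indicator sets_PiM_I_finite) auto
  also have "\<dots> = (\<Prod>i<n. emeasure lborel {0..real R})"
    by (rule emeasure_PiM) auto
  also have "\<dots> < \<infinity>" by (simp add: ennreal_power)
  finally show "emeasure (mu (box_density R)) (space M) < \<infinity>" .
qed

text \<open>Cubes of natural side length exhaust the orthant, and a countable union of null sets is
  null.\<close>

lemma AE_not_roaming: "AE x in M. x \<in> orthant \<longrightarrow> x \<notin> roaming"
proof -
  have "AE x in M. x \<in> orthant \<and> (\<forall>i<n. x i \<le> real R) \<longrightarrow> x \<notin> roaming" for R
  proof -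
    have hm: "box_density R \<in> borel_measurable M" using admissible_box[of R] by (simp add: admissible_def)
    then have [measurable]: "(\<lambda>x. box_density R x * indicator orthant x) \<in> borel_measurable M" by measurable
    have "AE x in mu (box_density R). x \<notin> roaming"
      using roaming_null[OF admissible_box] by (intro AE_not_in null_setsI) auto
    then have "AE x in M. 0 < box_density R x * indicator orthant x \<longrightarrow> x \<notin> roaming"
      unfolding mu_def by (subst (asm) AE_density) auto
    then show ?thesis
      by eventually_elim (auto simp: box_density_def orthant_def split: split_indicator_asm)
  qed
  then have "AE x in M. \<forall>R. x \<in> orthant \<and> (\<forall>i<n. x i \<le> real R) \<longrightarrow> x \<notin> roaming"
    by (intro AE_all_countable[THEN iffD2] allI)
  then show ?thesis
  proof eventually_elim
    case (elim x)
    obtain R where R: "Max (x ` {..<n}) \<le> real R" using real_arch_simple by blast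
    have "x i \<le> real R" if "i < n" for i
    proof -
      have "x i \<le> Max (x ` {..<n})" using that by (intro Max_ge) auto
      then show ?thesis using R by simp
    qed
    with elim show ?case by blast
  qed
qed

section \<open>Limits of an orbit that stays within one cell\<close>

lemma small_max:
  assumes "regular x" "x \<in> orthant"
  shows "0 < (MAX j\<in>small x. x j)" "\<And>j. j \<in> small x \<Longrightarrow> x j \<le> (MAX j\<in>small x. x j)"
    and "\<And>i. i \<in> {..<n} - small x \<Longrightarrow> (MAX j\<in>small x. x j) \<le> x i"
proof -
  note J = branchD[OF small_branch[OF assms(1)]]
  show le: "x j \<le> (MAX j\<in>small x. x j)" if "j \<in> small x" for j
    using that J by simp
  obtain j where j: "j \<in> small x" using J by auto
  then have "0 < x j" using assms regular_nonzero[of x j] J by (force simp: orthant_def)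
  then show "0 < (MAX j\<in>small x. x j)" using le[OF j] by simp
  show "(MAX j\<in>small x. x j) \<le> x i" if "i \<in> {..<n} - small x" for i
    using small_below[OF _ that] J by simp
qed

lemma step_le: "regular x \<Longrightarrow> x \<in> orthant \<Longrightarrow> step x i \<le> x i"
  using small_max(1)[of x] by (simp add: step_def shear_def)

lemma orbit_orthant:
  assumes "x \<in> orthant" "\<And>k. regular ((step ^^ k) x)"
  shows "(step ^^ k) x \<in> orthant"
  by (induction k) (use assms step_orthant in auto)

text \<open>All coordinates decrease and are bounded below, so they converge, and the subtracted
  amounts \<open>m k\<close>, being the decrements of the cell sum, tend to 0. Once the cell
  coordinates are known to vanish in the limit, the invariant \<open>x i - sum x K\<close> is the
  limit of \<open>z k i\<close>, hence nonnegative, and regularity makes it positive.\<close>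

lemma settled_limits:
  assumes x: "x \<in> orthant" "\<And>k. regular ((step ^^ k) x)"
    and K: "K \<in> cells" and sub: "\<And>k. small ((step ^^ k) x) \<subseteq> K"
  defines "z \<equiv> \<lambda>k. (step ^^ k) x"
  shows "\<And>i. i \<in> K \<Longrightarrow> (\<lambda>k. z k i) \<longlonglongrightarrow> 0"
    and "\<And>i k. i \<in> {..<n} - K \<Longrightarrow> z k i - sum (z k) K = x i - sum x K"
    and "\<And>i. i \<in> {..<n} - K \<Longrightarrow> 0 < x i - sum x K"
proof -
  note KD = cellD[OF K]
  define m where "m k = (MAX j\<in>small (z k). z k j)" for k
  have z_Suc: "z (Suc k) = step (z k)" for k by (simp add: z_def)
  have reg: "regular (z k)" and orth: "z k \<in> orthant" and subz: "small (z k) \<subseteq> K" for k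
    using x orbit_orthant[OF x] sub by (auto simp: z_def)
  have pos: "0 < z k i" if "i < n" for k i
    using orth[of k] regular_nonzero[OF reg that, of k] that by (force simp: orthant_def)
  have dec: "decseq (\<lambda>k. z k i)" for i
    using step_le[OF reg orth] by (intro decseq_SucI) (simp add: z_Suc)
  have sums: "sum (z (Suc k)) K = sum (z k) K - m k" for k
    using step_cell(1)[OF K reg subz] by (simp add: z_Suc m_def)
  have off: "z (Suc k) i = z k i - m k" if "i \<in> {..<n} - K" for k i
    using step_cell(2)[OF K reg subz that] by (simp add: z_Suc m_def)
  show const: "z k i - sum (z k) K = x i - sum x K" if "i \<in> {..<n} - K" for i k
    using that by (induction k) (simp_all add: sums off, simp add: z_def)
  have lim: "\<exists>L\<ge>0. (\<lambda>k. z k i) \<longlonglongrightarrow> L \<and> (\<forall>k. L \<le> z k i)" if i: "i < n" for i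
  proof -
    obtain L where L: "(\<lambda>k. z k i) \<longlonglongrightarrow> L" "\<And>k. L \<le> z k i"
      using decseq_convergent[OF dec, of 0 i] pos[OF i] by (auto simp: less_imp_le)
    moreover have "0 \<le> L" using pos[OF i] by (intro LIMSEQ_le_const[OF L(1)]) (auto simp: less_imp_le)
    ultimately show ?thesis by blast
  qed
  have "\<exists>S. (\<lambda>k. sum (z k) K) \<longlonglongrightarrow> S"
  proof -
    have "\<forall>i\<in>K. \<exists>L. (\<lambda>k. z k i) \<longlonglongrightarrow> L" using lim KD by (meson lessThan_iff subsetD)
    then obtain L where "\<forall>i\<in>K. (\<lambda>k. z k i) \<longlonglongrightarrow> L i" by metis
    then have "(\<lambda>k. sum (z k) K) \<longlonglongrightarrow> sum L K" by (intro tendsto_sum) auto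
    then show ?thesis by blast
  qed
  then obtain S where S: "(\<lambda>k. sum (z k) K) \<longlonglongrightarrow> S" by blast
  have "(\<lambda>k. sum (z k) K - sum (z (Suc k)) K) \<longlonglongrightarrow> S - S"
    by (intro tendsto_diff S LIMSEQ_Suc)
  then have m0: "m \<longlonglongrightarrow> 0" by (simp add: sums)
  show lim0: "(\<lambda>k. z k i) \<longlonglongrightarrow> 0" if i: "i \<in> K" for i
  proof -
    have "i < n" using i KD by auto
    then obtain L where L: "0 \<le> L" "(\<lambda>k. z k i) \<longlonglongrightarrow> L" "\<And>k. L \<le> z k i" using lim by blast
    have "L = 0"
    proof (rule ccontr)
      assume "L \<noteq> 0"
      then have "0 < L" using L by simp
      then obtain k0 where k0: "\<And>k. k \<ge> k0 \<Longrightarrow> m k < L"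
        using order_tendstoD(2)[OF m0] by (auto simp: eventually_sequentially)
      \<comment> \<open>From time \<open>k0\<close> on \<open>z k i \<ge> L > m k\<close>, so
        \<open>i\<close> is the one index of the cell that is left out.\<close>
      have "small (z k) = K - {i}" if "k \<ge> k0" for k
      proof (rule card_subset_eq)
        have "i \<notin> small (z k)"
          using small_max(2)[OF reg orth, of i k] k0[OF that] L(3)[of k] by (auto simp: m_def)
        then show "small (z k) \<subseteq> K - {i}" using subz by auto
        show "card (small (z k)) = card (K - {i})"
          using branchD[OF small_branch[OF reg]] KD i by simp
      qed (use KD in auto)
      note small_k = this
      \<comment> \<open>\<open>step\<close> does not move the a smallest coordinates. As these are
        now always the same ones, they freeze, and \<open>m\<close> stays at a positive constant,
        contrary to its limit 0.\<close>
      have z_k: "z k j = z k0 j" if "k \<ge> k0" "j \<in> K - {i}" for k j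
        using that(1)
      proof (induction k rule: dec_induct)
        case (step k)
        then show ?case using that(2) small_k[of k] by (simp add: z_Suc step_def shear_def)
      qed simp
      have m_k: "m k = m k0" if "k \<ge> k0" for k
        using z_k[OF that] small_k[OF that] small_k[of k0] by (simp add: m_def)
      have "m \<longlonglongrightarrow> m k0"
        by (rule tendsto_eventually, rule eventually_sequentiallyI, rule m_k)
      then have "m k0 = 0" using m0 LIMSEQ_unique by blast
      then show False using small_max(1)[OF reg orth, of k0] by (simp add: m_def)
    qed
    then show ?thesis using L by simp
  qed
  show "0 < x i - sum x K" if i: "i \<in> {..<n} - K" for i
  proof -
    have "(\<lambda>k. z k i - sum (z k) K) \<longlonglongrightarrow> x i - sum x K"
      using const[OF i] by simp
    moreover have "(\<lambda>k. sum (z k) K) \<longlonglongrightarrow> (\<Sum>i\<in>K. 0)"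
      by (intro tendsto_sum lim0)
    ultimately have "(\<lambda>k. z k i - sum (z k) K + sum (z k) K) \<longlonglongrightarrow> x i - sum x K + (\<Sum>i\<in>K. 0)"
      by (intro tendsto_add)
    then have "(\<lambda>k. z k i) \<longlonglongrightarrow> x i - sum x K" by simp
    then have "0 \<le> x i - sum x K"
      using i pos[of i] by (intro LIMSEQ_le_const) (auto simp: less_imp_le)
    moreover have "x i \<noteq> sum x K"
      using x(2)[of 0] i KD by (auto simp: regular_def)
    ultimately show ?thesis by simp
  qed
qed

lemma settles:
  assumes "x \<in> orthant" "x \<notin> roaming"
  obtains K k0 where "K \<in> cells" "\<And>k. k \<ge> k0 \<Longrightarrow> small ((step ^^ k) x) \<subseteq> K"
  using assms that unfolding roaming_def orthant_def by blast

section \<open>From the unsorted map back to \<open>T\<close>\<close>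

lemma mset_upt_split:
  assumes "J \<subseteq> {..<n}"
  shows "mset (sorted_list_of_set J) + mset (sorted_list_of_set ({..<n} - J)) = mset [0..<n]"
proof -
  have fin: "finite J" using assms finite_subset by blast
  have "mset (sorted_list_of_set J) + mset (sorted_list_of_set ({..<n} - J)) = mset_set J + mset_set ({..<n} - J)"
    using fin mset_set_set[of "sorted_list_of_set J"] mset_set_set[of "sorted_list_of_set ({..<n} - J)"] by simp
  also have "\<dots> = mset_set {..<n}"
    using assms fin by (subst mset_set_Union[symmetric]) (auto intro: arg_cong[where f = mset_set])
  also have "\<dots> = mset [0..<n]"
    using mset_set_set[of "[0..<n]"] by (simp add: lessThan_atLeast0)
  finally show ?thesis .
qed

lemma sort_split:
  fixes x :: "nat \<Rightarrow> real"
  assumes J: "J \<subseteq> {..<n}" and le: "\<And>i j. j \<in> J \<Longrightarrow> i \<in> {..<n} - J \<Longrightarrow> x j \<le> x i"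
  shows "sort (map x [0..<n]) =
    sort (map x (sorted_list_of_set J)) @ sort (map x (sorted_list_of_set ({..<n} - J)))"
proof (rule properties_for_sort)
  have fin: "finite J" using J finite_subset by blast
  show "mset (sort (map x (sorted_list_of_set J)) @ sort (map x (sorted_list_of_set ({..<n} - J)))) = mset (map x [0..<n])"
    using mset_upt_split[OF J] by (simp only: mset_append mset_sort mset_map image_mset_union[symmetric])
  show "sorted (sort (map x (sorted_list_of_set J)) @ sort (map x (sorted_list_of_set ({..<n} - J))))"
    using le fin by (auto simp: sorted_append)
qed

text \<open>Sorting conjugates \<open>step\<close> to \<open>T\<close>: the first a entries of the
  sorted vector are the values over \<open>small z\<close>, and \<open>T\<close> shifts the others
  by the same amount as \<open>step\<close> does. The lists before the final sort thus agree as
  multisets.\<close>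

lemma T_sorted:
  assumes z: "regular z" "z \<in> orthant"
    and y: "\<And>i. i < n \<Longrightarrow> y i = sort (map z [0..<n]) ! i" and i: "i < n"
  shows "T a (n - a) y i = sort (map (step z) [0..<n]) ! i"
proof -
  define J where "J = small z"
  note JD = branchD[OF small_branch[OF z(1)], folded J_def]
  define Jl where "Jl = sorted_list_of_set J"
  define Cl where "Cl = sorted_list_of_set ({..<n} - J)"
  define m where "m = (MAX j\<in>J. z j)"
  have n: "a + (n - a) = n" using a_less by simp
  have split: "sort (map z [0..<n]) = sort (map z Jl) @ sort (map z Cl)"
    unfolding Jl_def Cl_def using small_below JD by (intro sort_split) (auto simp: J_def)
  have len: "length Jl = a" "length Cl = n - a" using JD by (auto simp: Jl_def Cl_def card_Diff_subset)
  have y1: "map y [0..<a] = sort (map z Jl)"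
    using y len a_less by (intro nth_equalityI) (auto simp: split nth_append)
  have y2: "map y [a..<n] = sort (map z Cl)"
    using y len a_less by (intro nth_equalityI) (auto simp: split nth_append)
  \<comment> \<open>With indices from 0, entry \<open>a - 1\<close> is the last of the first sorted
    block, that is, the maximum over \<open>J\<close>.\<close>
  have m: "y (a - 1) = m"
  proof -
    have ne: "z ` J \<noteq> {}" "finite (z ` J)" using JD by auto
    have set: "set (sort (map z Jl)) = z ` J" using JD by (simp add: Jl_def)
    have ya: "y (a - 1) = sort (map z Jl) ! (a - 1)"
      using a_pos by (simp add: y1[symmetric])
    have "y (a - 1) \<in> z ` J"
      unfolding ya set[symmetric] using len a_pos by (intro nth_mem) simp
    moreover have "v \<le> y (a - 1)" if "v \<in> z ` J" for v
    proof -
      have "v \<in> set (sort (map z Jl))" using that unfolding set .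
      then obtain k where k: "k < length (sort (map z Jl))" "sort (map z Jl) ! k = v"
        unfolding in_set_conv_nth by blast
      have ka: "k < a" using k(1) by (simp add: len)
      have "sort (map z Jl) ! k \<le> sort (map z Jl) ! (a - 1)"
      proof (rule sorted_nth_mono)
        show "k \<le> a - 1" using ka by simp
        show "a - 1 < length (sort (map z Jl))" using a_pos by (simp add: len)
        show "sorted (sort (map z Jl))" by simp
      qed
      then show ?thesis unfolding ya k(2) .
    qed
    ultimately show ?thesis unfolding m_def using ne by (intro Max_eqI[symmetric]) auto
  qed
  have "mset (map y [0..<a] @ map (\<lambda>i. y i - y (a - 1)) [a..<n]) =
      mset (map y [0..<a]) + mset (map (\<lambda>v. v - m) (map y [a..<n]))"
    unfolding m map_map by (simp add: o_def)
  also have "\<dots> = mset (map z Jl) + mset (map (\<lambda>v. v - m) (map z Cl))"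
    by (simp only: y1 y2 mset_sort mset_map)
  also have "mset (map z Jl) = mset (map (step z) Jl)"
    using JD by (intro arg_cong[where f = mset] map_cong) (auto simp: Jl_def step_def shear_def J_def)
  also have "mset (map (\<lambda>v. v - m) (map z Cl)) = mset (map (step z) Cl)"
    unfolding map_map by (intro arg_cong[where f = mset] map_cong) (auto simp: Cl_def step_def shear_def J_def m_def)
  also have "mset (map (step z) Jl) + mset (map (step z) Cl) = mset (map (step z) [0..<n])"
    using mset_upt_split[OF JD(1)] by (simp only: Jl_def Cl_def mset_map image_mset_union[symmetric])
  finally have "sort (map y [0..<a] @ map (\<lambda>i. y i - y (a - 1)) [a..<n]) = sort (map (step z) [0..<n])"
    by (metis sorted_list_of_multiset_mset)
  then show ?thesis using i by (simp add: T_def n Let_def)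
qed

lemma T_funpow:
  assumes x: "x \<in> orthant" "\<And>k. regular ((step ^^ k) x)" "x \<in> Lambda n" and i: "i < n"
  shows "(T a (n - a) ^^ k) x i = sort (map ((step ^^ k) x) [0..<n]) ! i"
  using i
proof (induction k arbitrary: i)
  case 0
  have "sorted (map x [0..<n])"
    using x(3) by (auto simp: Lambda_def sorted_iff_nth_Suc)
  then have "sort (map x [0..<n]) = map x [0..<n]" by (rule sorted_sort_id)
  then show ?case using 0 by simp
next
  case (Suc k)
  then show ?case using T_sorted[OF x(2) orbit_orthant[OF x(1,2)], of "(T a (n - a) ^^ k) x" k i] by simp
qed

text \<open>After settling in \<open>K\<close>, the sorted vector is the sorted cell block, squeezed
  between 0 and the cell sum, followed by the sorted constants \<open>D i\<close>, all translated by
  that same sum. The sum tends to 0.\<close>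

lemma T_limit:
  assumes x: "x \<in> orthant" "\<And>k. regular ((step ^^ k) x)" "x \<in> Lambda n" "x \<notin> roaming"
  shows "\<exists>y. (\<forall>i<n. (\<lambda>k. (T a (n - a) ^^ k) x i) \<longlonglongrightarrow> y i)
                \<and> (\<forall>i<a+1. y i = 0)
                \<and> 0 < y (a+1)
                \<and> (\<forall>i. a+1 \<le> i \<and> Suc i < n \<longrightarrow> y i \<le> y (Suc i))"
proof -
  obtain K k0 where K: "K \<in> cells" and sub: "\<And>k. k \<ge> k0 \<Longrightarrow> small ((step ^^ k) x) \<subseteq> K"
    using settles[OF x(1,4)] by blast
  note KD = cellD[OF K]
  \<comment> \<open>The orbit restarted at \<open>k0\<close>, so that the cell condition holds from
    time 0.\<close>
  define z where "z k = (step ^^ k) ((step ^^ k0) x)" for k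
  have z_eq: "z k = (step ^^ (k + k0)) x" for k by (simp add: z_def funpow_add)
  have z0: "z 0 = (step ^^ k0) x" by (simp add: z_def)
  have z: "z k = (step ^^ k) (z 0)" for k by (simp add: z_def)
  have orth: "z k \<in> orthant" for k unfolding z_eq by (rule orbit_orthant[OF x(1,2)])
  have reg: "regular ((step ^^ k) (z 0))" for k using x(2)[of "k + k0"] by (simp add: z0 funpow_add)
  have subz: "small ((step ^^ k) (z 0)) \<subseteq> K" for k using sub[of "k + k0"] by (simp add: z0 funpow_add)
  define D where "D i = z 0 i - sum (z 0) K" for i
  have lim: "(\<lambda>k. z k i) \<longlonglongrightarrow> 0" if "i \<in> K" for i
    using settled_limits(1)[OF orth reg K subz that] by (simp only: z[symmetric])
  have off: "z k i = D i + sum (z k) K" if "i \<in> {..<n} - K" for i k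
    using settled_limits(2)[OF orth reg K subz that, of k] unfolding D_def z[symmetric] by linarith
  have D_pos: "0 < D i" if "i \<in> {..<n} - K" for i
    using settled_limits(3)[OF orth reg K subz that] by (simp add: D_def)
  have le_sum: "z k j \<le> sum (z k) K" if "j \<in> K" for k j
    using orth[of k] KD that by (intro member_le_sum) (auto simp: orthant_def)
  have sum0: "(\<lambda>k. sum (z k) K) \<longlonglongrightarrow> 0"
  proof -
    have "(\<lambda>k. sum (z k) K) \<longlonglongrightarrow> (\<Sum>i\<in>K. 0)" by (intro tendsto_sum lim)
    then show ?thesis by simp
  qed
  define Kl where "Kl = sorted_list_of_set K"
  define Cl where "Cl = sorted_list_of_set ({..<n} - K)"
  have len: "length Kl = Suc a" "length Cl = n - Suc a"
    using KD by (auto simp: Kl_def Cl_def card_Diff_subset)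
  \<comment> \<open>The translation is common to all indices outside \<open>K\<close>, so their
    order is the order of the constants \<open>D\<close> at all times.\<close>
  have sort_Cl: "sort (map (z k) Cl) = map (\<lambda>d. d + sum (z k) K) (sort (map D Cl))" for k
  proof (rule properties_for_sort)
    have "map (z k) Cl = map (\<lambda>d. d + sum (z k) K) (map D Cl)"
      using off by (auto simp: Cl_def)
    then show "mset (map (\<lambda>d. d + sum (z k) K) (sort (map D Cl))) = mset (map (z k) Cl)"
      by (simp only: mset_map mset_sort)
    show "sorted (map (\<lambda>d. d + sum (z k) K) (sort (map D Cl)))"
      by (simp add: sorted_map)
  qed
  have split: "sort (map (z k) [0..<n]) = sort (map (z k) Kl) @ map (\<lambda>d. d + sum (z k) K) (sort (map D Cl))" for k
    unfolding sort_Cl[symmetric] unfolding Kl_def Cl_def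
  proof (rule sort_split[OF KD(1)])
    fix i j assume "j \<in> K" "i \<in> {..<n} - K"
    then show "z k j \<le> z k i" using le_sum[of j k] off[of i k] D_pos[of i] by simp
  qed
  define y where "y i = (if i < a + 1 then 0 else sort (map D Cl) ! (i - (a + 1)))" for i
  have Tz: "(T a (n - a) ^^ (k + k0)) x i = sort (map (z k) [0..<n]) ! i" if "i < n" for i k
    unfolding z_eq by (rule T_funpow[OF x(1-3) that])
  have conv: "(\<lambda>k. (T a (n - a) ^^ k) x i) \<longlonglongrightarrow> y i" if i: "i < n" for i
  proof (rule LIMSEQ_offset[where k = k0], cases "i < a + 1")
    case True
    have "0 \<le> sort (map (z k) [0..<n]) ! i \<and> sort (map (z k) [0..<n]) ! i \<le> sum (z k) K" for k
    proof -
      have "sort (map (z k) Kl) ! i \<in> set (sort (map (z k) Kl))"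
        using True len by (intro nth_mem) simp
      then obtain j where j: "j \<in> K" "sort (map (z k) Kl) ! i = z k j"
        using KD by (auto simp: Kl_def)
      have "sort (map (z k) [0..<n]) ! i = z k j"
        unfolding split using True len j(2) by (simp add: nth_append)
      then show ?thesis using le_sum[OF j(1)] orth[of k] j(1) KD by (auto simp: orthant_def)
    qed
    then have "(\<lambda>k. sort (map (z k) [0..<n]) ! i) \<longlonglongrightarrow> 0"
      by (intro tendsto_sandwich[OF _ _ tendsto_const sum0]) auto
    then show "(\<lambda>k. (T a (n - a) ^^ (k + k0)) x i) \<longlonglongrightarrow> y i"
      using True by (simp add: Tz[OF i] y_def)
  next
    case False
    have "sort (map (z k) [0..<n]) ! i = y i + sum (z k) K" for k
      unfolding split using False len i by (simp add: nth_append y_def)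
    moreover have "(\<lambda>k. y i + sum (z k) K) \<longlonglongrightarrow> y i + 0"
      by (intro tendsto_add tendsto_const sum0)
    ultimately show "(\<lambda>k. (T a (n - a) ^^ (k + k0)) x i) \<longlonglongrightarrow> y i"
      by (simp add: Tz[OF i])
  qed
  \<comment> \<open>The second block has n - (a + 1) \<ge> 1 entries because b \<ge> 2, so entry a +
    1 of the limit is one of the positive constants \<open>D i\<close>.\<close>
  have "sort (map D Cl) ! 0 \<in> set (sort (map D Cl))"
    using len a_less by (intro nth_mem) simp
  then have "0 < y (a + 1)"
    using D_pos by (auto simp: y_def Cl_def)
  moreover have "y i \<le> y (Suc i)" if "a + 1 \<le> i" "Suc i < n" for i
  proof -
    have "sort (map D Cl) ! (i - (a + 1)) \<le> sort (map D Cl) ! (Suc i - (a + 1))"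
      using that len by (intro sorted_nth_mono) auto
    then show ?thesis using that by (simp add: y_def)
  qed
  ultimately show ?thesis using conv by (intro exI[of _ y]) (auto simp: y_def)
qed

lemma Lambda_orthant:
  assumes "x \<in> Lambda n"
  shows "x \<in> orthant"
proof -
  have "0 \<le> x i" if "i < n" for i
    using that assms
  proof (induction i)
    case (Suc i)
    then have "0 \<le> x i" "x i \<le> x (Suc i)" by (auto simp: Lambda_def)
    then show ?case by simp
  qed (auto simp: Lambda_def)
  then show ?thesis using assms by (auto simp: orthant_def Lambda_def space_PiM)
qed

end

theorem theorem1p2:
  fixes a b :: nat
  assumes "a \<ge> 1" and "b \<ge> 2"
  shows "AE x in PiM {..<a+b} (\<lambda>_. lborel).
           x \<in> Lambda (a+b) \<longrightarrow>
           (\<exists>y. (\<forall>i<a+b. (\<lambda>k. ((T a b) ^^ k) x i) \<longlonglongrightarrow> y i)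
                \<and> (\<forall>i<a+1. y i = 0)
                \<and> 0 < y (a+1)
                \<and> (\<forall>i. a+1 \<le> i \<and> Suc i < a+b \<longrightarrow> y i \<le> y (Suc i)))"
proof -
  \<comment> \<open>With n = a + b the parameter \<open>n - a\<close> of \<open>T\<close> becomes
    b.\<close>
  interpret selmer a "a + b"
    using assms by unfold_locales auto
  show ?thesis
    using AE_not_roaming AE_regular_orbit
  proof eventually_elim
    case (elim x)
    then show ?case using T_limit[of x] Lambda_orthant[of x] by simp
  qed
qed

end
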